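(* Let $m$ be a positive integer, $q=2^m$, $n$ an odd positive integer, and $\gamma\in\mathbb{F}_{q^n}$. Let $f(X)=X+\gamma\,\mathrm{Tr}_{q}^{q^n}\left(X^{\frac{q+q^2}{2}}\right)$, a polynomial over $\mathbb{F}_{q^n}$. Then $f(X)$ is a permutation polynomial over $\mathbb{F}_{q^n}$ if and only if $\gamma\in\mathbb{F}_q\setminus\{1\}$. Moreover, in that case the compositional inverse of $f$ is $f^{-1}(X)=X+\frac{\gamma}{\gamma+1}\,\mathrm{Tr}_{q}^{q^n}\left(X^{\frac{q+q^2}{2}}\right)$.
   Context: For a prime power $q$, $\mathbb{F}_q$ is the finite field with $q$ elements. $\mathrm{Tr}_{q}^{q^n}(x)=x+x^q+\cdots+x^{q^{n-1}}$ is the relative trace from $\mathbb{F}_{q^n}$ to $\mathbb{F}_q$. A polynomial $f\in\mathbb{F}_{Q}[X]$ is a permutation polynomial over $\mathbb{F}_{Q}$ if the map $c\mapsto f(c)$ is a bijection of $\mathbb{F}_{Q}$ to itself. The compositional inverse $f^{-1}$ of a permutation polynomial $f$ over $\mathbb{F}_Q$ is the polynomial, unique modulo $X^{Q}-X$, with $f^{-1}(f(X))\equiv f(f^{-1}(X))\equiv X\pmod{X^{Q}-X}$; polynomials are identified with the functions on $\mathbb{F}_Q$ they induce. *)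

theory Defs
  imports
    "HOL-Library.Cardinality"
    "HOL-Number_Theory.Cong"
    "HOL-Computational_Algebra.Polynomial"
    "HOL-Algebra.Algebraic_Closure_Type"
begin

text \<open>
  The field with \<open>q^n\<close> elements is a type \<open>'a :: {field, finite}\<close> with \<open>CARD('a) = q^n\<close>;
  its subfield with \<open>q\<close> elements is a set \<open>K\<close> with \<open>subfield K ring_of_type_algebra\<close> and
  \<open>card K = q\<close>.
\<close>

text \<open>
  The trace expression \<open>x + x^q + \<dots> + x^(q^(n-1))\<close>. It is polymorphic so that it can be applied
  both to field elements and, as in \<open>Tr(X^k)\<close>, to polynomials.
\<close>

definition rel_trace :: "nat \<Rightarrow> nat \<Rightarrow> 'b::comm_semiring_1 \<Rightarrow> 'b" where
  "rel_trace q n x = (\<Sum>i<n. x ^ (q ^ i))"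

lemma poly_rel_trace: "poly (rel_trace q n p) c = rel_trace q n (poly p c)"
  by (simp add: rel_trace_def poly_sum)

definition permutation_poly :: "'a::{field,finite} poly \<Rightarrow> bool" where
  "permutation_poly f \<longleftrightarrow> bij (poly f)"

text \<open>
  A compositional inverse is determined only modulo \<open>X^Q - X\<close>, \<open>Q\<close> being the size of the field, so
  it is a relation between polynomials.
\<close>

definition compositional_inverse :: "'a::{field,finite} poly \<Rightarrow> 'a poly \<Rightarrow> bool" where
  "compositional_inverse f g \<longleftrightarrow>
     [pcompose g f = [:0, 1:]] (mod ([:0, 1:] ^ CARD('a) - [:0, 1:])) \<and>
     [pcompose f g = [:0, 1:]] (mod ([:0, 1:] ^ CARD('a) - [:0, 1:]))"

end

theory Submission
  imports Defs
begin

text \<open>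
  In characteristic 2 the square of \<open>T(x) = Tr(x^((q+q^2)/2))\<close> is the quadratic form
  \<open>Tr(x x^q)\<close> over \<open>K\<close>. Its polar form is \<open>Tr(x^q (y + y^(q^2)))\<close>, and since \<open>n\<close> is odd the radical
  of the form is exactly \<open>K\<close>, on which \<open>T\<close> is the identity. Hence \<open>T(x + c) = T(x) + c\<close> for
  \<open>c \<in> K\<close>, so for \<open>\<gamma> \<in> K\<close> the value \<open>T\<close> is multiplied by \<open>1 + \<gamma>\<close> under
  \<open>x \<mapsto> x + \<gamma> T(x)\<close>: this gives the inverse when \<open>\<gamma> \<noteq> 1\<close>, and for \<open>\<gamma> = 1\<close> the map kills \<open>K\<close>.
  If \<open>\<gamma> \<notin> K\<close>, the polar form with \<open>\<gamma>\<close> takes every value in \<open>K\<close>, so there is an \<open>x\<close> with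
  \<open>T(x + \<gamma>) = T(x) + 1\<close>, and \<open>x\<close> and \<open>x + \<gamma>\<close> have the same image.
\<close>

section \<open>Powers in finite multiplicatively closed sets\<close>

lemma power_card_eq_1_if_mult_closed:
  fixes S :: "'a::field set"
  assumes "finite S" "0 \<notin> S" and closed: "\<And>x y. x \<in> S \<Longrightarrow> y \<in> S \<Longrightarrow> x * y \<in> S" and x: "x \<in> S"
  shows "x ^ card S = 1"
proof -
  have nz: "x \<noteq> 0" using assms by auto
  have inj: "inj_on ((*) x) S" using nz by (auto intro: inj_onI)
  \<comment> \<open>An injective self-map of the finite set \<open>S\<close> is onto, so
    multiplication by \<open>x\<close> only permutes the factors of the product over
    \<open>S\<close>.\<close>
  have "(*) x ` S = S"
    by (rule endo_inj_surj) (use assms inj in auto)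
  then have "\<Prod>S = (\<Prod>s\<in>S. x * s)"
    using prod.reindex[OF inj, of "\<lambda>s. s"] by simp
  also have "\<dots> = x ^ card S * \<Prod>S" by (simp add: prod.distrib)
  finally have "\<Prod>S = x ^ card S * \<Prod>S" .
  moreover have "\<Prod>S \<noteq> 0" using assms by auto
  ultimately show ?thesis by simp
qed

text \<open>Removing 0 leaves a closed set, and restoring it raises the exponent by one. Stating
  this for a set serves both the whole field and \<open>K\<close>.\<close>

lemma power_card_eq_self_if_mult_closed:
  fixes S :: "'a::field set"
  assumes "finite S" "0 \<in> S" and closed: "\<And>x y. x \<in> S \<Longrightarrow> y \<in> S \<Longrightarrow> x * y \<in> S" and x: "x \<in> S"
  shows "x ^ card S = x"
proof (cases "x = 0")
  case True
  have "card S \<noteq> 0" using assms by auto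
  with True show ?thesis by simp
next
  case False
  have "x ^ card (S - {0}) = 1"
    by (rule power_card_eq_1_if_mult_closed) (use assms False in auto)
  moreover have "card S = Suc (card (S - {0}))"
    using assms by (metis card.remove)
  ultimately show ?thesis by simp
qed

lemma power_CARD_eq_self: "(x :: 'a::{field,finite}) ^ CARD('a) = x"
  by (rule power_card_eq_self_if_mult_closed) auto

section \<open>Roots of \<open>X^N - X\<close> and congruence modulo it\<close>

lemma degree_monom_diff_X:
  assumes "N > 1"
  shows "degree ([:0, 1:] ^ N - [:0, 1:] :: 'a::idom poly) = N"
  using degree_add_eq_left[of "- [:0, 1:]" "[:0, 1:] ^ N :: 'a poly"] assms
  by (simp add: degree_power_eq del: minus_pCons)

lemma card_power_fixed_points_le:
  assumes "N > 1"
  shows "finite {x::'a::idom. x ^ N = x}" "card {x::'a. x ^ N = x} \<le> N"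
proof -
  let ?p = "[:0, 1:] ^ N - [:0, 1:] :: 'a poly"
  have nz: "?p \<noteq> 0" using degree_monom_diff_X[OF assms, where ?'a = 'a] assms by auto
  have eq: "{x::'a. x ^ N = x} = {x. poly ?p x = 0}" by simp
  show "finite {x::'a. x ^ N = x}"
    unfolding eq by (rule poly_roots_finite[OF nz])
  show "card {x::'a. x ^ N = x} \<le> N"
    unfolding eq using card_poly_roots_bound[OF nz] degree_monom_diff_X[OF assms, where ?'a = 'a]
    by simp
qed

lemma two_le_CARD: "CARD('a::{zero_neq_one,finite}) > 1"
  using card_mono[of UNIV "{0, 1::'a}"] by simp

text \<open>The remainder of \<open>p - r\<close> has degree below the field size but vanishes at
  every field element, so it is zero. Pointwise inverses thereby become inverses in the polynomial
  sense.\<close>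

lemma poly_cong_if_eq_everywhere:
  fixes p r :: "'a::{field,finite} poly"
  assumes "\<And>x. poly p x = poly r x"
  shows "[p = r] (mod ([:0, 1:] ^ CARD('a) - [:0, 1:]))"
proof -
  define M :: "'a poly" where "M = [:0, 1:] ^ CARD('a) - [:0, 1:]"
  have deg: "degree M = CARD('a)"
    unfolding M_def by (rule degree_monom_diff_X[OF two_le_CARD])
  have zero: "poly M x = 0" for x
    by (simp add: M_def power_CARD_eq_self)
  have "poly ((p - r) mod M) x = 0" for x
    by (simp add: poly_mod zero assms)
  moreover have "(p - r) mod M = 0 \<or> degree ((p - r) mod M) < CARD('a)"
    using degree_mod_less[of M "p - r"] deg by fastforce
  ultimately have "(p - r) mod M = 0"
    using card_poly_roots_bound[of "(p - r) mod M"] by fastforce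
  then show ?thesis
    unfolding M_def by (simp add: cong_iff_dvd_diff mod_eq_0_iff_dvd)
qed

section \<open>Characteristic 2\<close>

lemma two_eq_0_if_CARD_even:
  assumes "even (CARD('a))"
  shows "(2 :: 'a::{field,finite}) = 0"
proof -
  have "(-1 :: 'a) = (-1) ^ CARD('a)" by (simp only: power_CARD_eq_self)
  also have "\<dots> = 1" using assms by simp
  finally have "(1 + 1 :: 'a) = 0" by (metis add.right_inverse)
  then show ?thesis by simp
qed

locale odd_extension_char_2 =
  fixes m n q :: nat and K :: "'a::{field,finite} set"
  assumes m_pos: "m > 0" and q_def: "q = 2 ^ m" and odd_n: "odd n"
    and CARD_eq: "CARD('a) = q ^ n"
    and subfield_K: "subfield K (ring_of_type_algebra :: 'a ring)" and card_K: "card K = q"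
begin

abbreviation tr :: "'a \<Rightarrow> 'a" where
  "tr \<equiv> rel_trace q n"

definition T :: "'a \<Rightarrow> 'a" where
  "T x = tr (x ^ ((q + q ^ 2) div 2))"

lemma even_q: "even q"
  using m_pos by (simp add: q_def)

lemma q_gt_1: "q > 1"
  using m_pos one_less_power[of "2 :: nat" m] by (simp add: q_def)

lemma n_pos: "n > 0"
  using odd_n by (auto intro: ccontr)

lemma two_eq_0: "(2 :: 'a) = 0"
  by (rule two_eq_0_if_CARD_even) (use even_q n_pos in \<open>simp add: CARD_eq\<close>)

lemma add_self: "(x :: 'a) + x = 0"
  using two_eq_0 by (metis mult_2 mult_zero_left)

lemma uminus_eq: "- (x :: 'a) = x"
  using add_self by (metis add_eq_0_iff2)

lemma CHAR_eq_2: "CHAR('a) = 2"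
proof -
  have "of_nat 2 = (0 :: 'a)" using two_eq_0 by simp
  then have "CHAR('a) dvd 2" by (simp only: of_nat_eq_0_iff_char_dvd)
  moreover have "CHAR('a) \<noteq> 1" by simp
  ultimately show ?thesis using two_is_prime_nat prime_nat_iff by blast
qed

lemma power_2_power_add: "((x :: 'a) + y) ^ (2 ^ k) = x ^ (2 ^ k) + y ^ (2 ^ k)"
  by (rule freshmans_dream') (simp_all add: CHAR_eq_2)

lemma power_2_power_sum: "sum f A ^ (2 ^ k) = (\<Sum>i\<in>A. (f i :: 'a) ^ (2 ^ k))"
  by (rule freshmans_dream_sum') (simp_all add: CHAR_eq_2)

lemma q_power: "q ^ i = 2 ^ (m * i)"
  by (simp add: q_def power_mult)

lemma power_q_power_add: "((x :: 'a) + y) ^ (q ^ i) = x ^ (q ^ i) + y ^ (q ^ i)"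
  unfolding q_power by (rule power_2_power_add)

lemma power_q_add: "((x :: 'a) + y) ^ q = x ^ q + y ^ q"
  using power_q_power_add[of x y 1] by simp

lemma power_q_n: "(x :: 'a) ^ (q ^ n) = x"
  using power_CARD_eq_self[of x] by (simp add: CARD_eq)

text \<open>The square roots \<open>y\<close> and \<open>- y\<close> coincide in characteristic 2,
  so identities for \<open>T\<close> can be checked after squaring.\<close>

lemma square_inj: "(x :: 'a) ^ 2 = y ^ 2 \<Longrightarrow> x = y"
  by (simp add: power2_eq_iff uminus_eq)

section \<open>The subfield and the trace\<close>

lemma K_closed:
  "0 \<in> K" "1 \<in> K" "x \<in> K \<Longrightarrow> y \<in> K \<Longrightarrow> x * y \<in> K" "x \<in> K \<Longrightarrow> y \<in> K \<Longrightarrow> x + y \<in> K"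
  using subdomainE(2,3,6,7)[OF subfield.axioms(1)[OF subfield_K]]
  by (simp_all add: ring_of_type_algebra_def)

text \<open>All \<open>q\<close> elements of \<open>K\<close> are roots of \<open>X^q - X\<close>,
  which has at most \<open>q\<close> roots, so there are no others.\<close>

lemma K_iff: "x \<in> K \<longleftrightarrow> x ^ q = x"
proof -
  have "K \<subseteq> {x. x ^ q = x}"
    using power_card_eq_self_if_mult_closed[of K] K_closed by (auto simp: card_K)
  with card_power_fixed_points_le[OF q_gt_1, where ?'a = 'a] have "K = {x. x ^ q = x}"
    by (intro card_seteq) (simp_all add: card_K)
  then show ?thesis by auto
qed

lemma power_q_power_K: "x \<in> K \<Longrightarrow> x ^ (q ^ i) = x"
  by (induction i) (auto simp: K_iff power_mult)

lemma tr_add: "tr (x + y) = tr x + tr y"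
  by (simp add: rel_trace_def power_q_power_add sum.distrib)

lemma tr_scale: "c \<in> K \<Longrightarrow> tr (c * x) = c * tr x"
  by (simp add: rel_trace_def power_mult_distrib power_q_power_K sum_distrib_left)

lemma tr_K: "c \<in> K \<Longrightarrow> tr c = c"
proof -
  assume "c \<in> K"
  then have "tr c = of_nat n * c" by (simp add: rel_trace_def power_q_power_K)
  also have "of_nat n = (1 :: 'a)"
    using odd_n two_eq_0 by (auto elim!: oddE)
  finally show ?thesis by simp
qed

lemma tr_power_2: "tr (x ^ 2) = tr x ^ 2"
proof -
  have "tr x ^ 2 = (\<Sum>i<n. (x ^ (q ^ i)) ^ 2)"
    using power_2_power_sum[of "\<lambda>i. x ^ (q ^ i)" "{..<n}" 1] by (simp add: rel_trace_def)
  also have "\<dots> = tr (x ^ 2)"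
    unfolding rel_trace_def by (simp only: mult.commute flip: power_mult)
  finally show ?thesis ..
qed

lemma tr_power_q: "tr (x ^ q) = tr x"
proof -
  \<comment> \<open>Adding \<open>x\<close> completes the shifted sum to the indices 0 to
    \<open>n\<close>, whose last term is \<open>x\<close> again.\<close>
  have "tr (x ^ q) + x = (\<Sum>i<n. x ^ (q ^ Suc i)) + x ^ (q ^ 0)"
    by (simp add: rel_trace_def power_mult)
  also have "\<dots> = (\<Sum>i<Suc n. x ^ (q ^ i))"
    by (subst sum.lessThan_Suc_shift) (simp add: add.commute)
  also have "\<dots> = tr x + x"
    by (simp add: rel_trace_def power_q_n)
  finally show ?thesis by simp
qed

lemma tr_in_K: "tr x \<in> K"
proof -
  have "tr x ^ q = tr (x ^ q)"
    unfolding rel_trace_def q_def power_2_power_sum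
    by (simp flip: power_mult add: mult.commute)
  then show ?thesis by (simp add: K_iff tr_power_q)
qed

text \<open>As a polynomial the trace has degree at most \<open>q ^ (n - 1)\<close>, too small for
  all \<open>q ^ n\<close> field elements to be roots.\<close>

lemma tr_not_zero: "\<exists>x. tr x \<noteq> 0"
proof (rule ccontr)
  assume "\<not> ?thesis"
  then have zero: "tr x = 0" for x by simp
  let ?p = "rel_trace q n [:0, 1:] :: 'a poly"
  have X_power: "[:0, 1:] ^ k = (monom 1 k :: 'a poly)" for k
    by (simp add: monom_altdef)
  have power_eq_1: "q ^ i = 1 \<longleftrightarrow> i = 0" for i
    using q_gt_1 by simp
  \<comment> \<open>Only the summand with \<open>i = 0\<close> contributes to the linear
    coefficient, so the polynomial is nonzero.\<close>
  have "coeff ?p 1 = (\<Sum>i<n. if i = 0 then 1 else 0)"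
    unfolding rel_trace_def coeff_sum X_power coeff_monom power_eq_1 ..
  then have "?p \<noteq> 0" using n_pos by auto
  moreover have "degree ?p \<le> q ^ (n - 1)"
    unfolding rel_trace_def
    by (intro degree_sum_le) (use q_gt_1 in \<open>auto simp: degree_power_eq intro!: power_increasing\<close>)
  moreover have "q ^ (n - 1) < q ^ n"
    using q_gt_1 n_pos by simp
  ultimately show False
    using card_poly_roots_bound[of ?p] zero by (simp add: poly_rel_trace CARD_eq)
qed

section \<open>The quadratic form \<open>T x ^ 2\<close>\<close>

lemma T_in_K: "T x \<in> K"
  by (simp add: T_def tr_in_K)

lemma T_power_2: "T x ^ 2 = tr (x * x ^ q)"
proof -
  have "T x ^ 2 = tr (x ^ ((q + q ^ 2) div 2 * 2))"
    unfolding T_def by (simp only: power_mult tr_power_2)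
  \<comment> \<open>The division is exact because \<open>q\<close> is even; the resulting power is
    the \<open>q\<close>-th power of \<open>x * x ^ q\<close>, and the trace absorbs that outer
    power.\<close>
  also have "(q + q ^ 2) div 2 * 2 = Suc q * q"
    using even_q by (simp add: power2_eq_square algebra_simps)
  also have "tr (x ^ (Suc q * q)) = tr (x * x ^ q)"
    unfolding power_mult tr_power_q by simp
  finally show ?thesis .
qed

lemma T_add_power_2: "T (x + y) ^ 2 = T x ^ 2 + T y ^ 2 + tr (x ^ q * (y + y ^ (q ^ 2)))"
proof -
  have "T (x + y) ^ 2 = T x ^ 2 + T y ^ 2 + (tr (x * y ^ q) + tr (x ^ q * y))"
    by (simp add: T_power_2 power_q_add algebra_simps tr_add)
  \<comment> \<open>Raising to the \<open>q\<close>-th power inside the trace makes both cross terms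
    linear in \<open>x ^ q\<close>.\<close>
  also have "tr (x * y ^ q) = tr (x ^ q * y ^ (q ^ 2))"
    by (subst tr_power_q[symmetric]) (simp add: power_mult_distrib power2_eq_square power_mult)
  finally show ?thesis by (simp add: distrib_left tr_add add_ac)
qed

lemma T_K: "c \<in> K \<Longrightarrow> T c = c"
proof (rule square_inj)
  assume c: "c \<in> K"
  then have "c ^ q = c" by (simp add: K_iff)
  then have "T c ^ 2 = c * c"
    using c by (simp add: T_power_2 tr_scale tr_K)
  then show "T c ^ 2 = c ^ 2" by (simp only: power2_eq_square)
qed

text \<open>For \<open>c\<close> in \<open>K\<close> the coefficient \<open>c + c ^ (q ^ 2)\<close>
  equals \<open>c + c = 0\<close>, so the polar term vanishes.\<close>

lemma T_add_K: "c \<in> K \<Longrightarrow> T (x + c) = T x + c"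
proof (rule square_inj)
  assume c: "c \<in> K"
  have tr0: "tr 0 = 0" using tr_K K_closed by blast
  show "T (x + c) ^ 2 = (T x + c) ^ 2"
    using power_2_power_add[of "T x" c 1] c
    by (simp add: T_add_power_2 power_q_power_K add_self T_K tr0)
qed

text \<open>Such a \<open>y\<close> is fixed by the \<open>q ^ 2\<close> power and by the
  \<open>q ^ n\<close> power; as \<open>n\<close> is odd, it is fixed by the \<open>q\<close>-th
  power.\<close>

lemma radical_subset_K:
  assumes "y + y ^ (q ^ 2) = 0"
  shows "y \<in> K"
proof -
  have y: "y ^ (q ^ 2) = y"
    using assms by (metis add_eq_0_iff uminus_eq)
  have even_power: "y ^ (q ^ (2 * k)) = y" for k
  proof (induction k)
    case (Suc k)
    have "q ^ (2 * Suc k) = q ^ 2 * q ^ (2 * k)" by (simp add: power2_eq_square)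
    with Suc show ?case by (simp only: power_mult y)
  qed simp
  from odd_n obtain k where "n = 2 * k + 1" by (rule oddE)
  then have "y = (y ^ (q ^ (2 * k))) ^ q"
    using power_q_n[of y] by (simp add: mult.commute flip: power_mult)
  then show ?thesis by (simp add: even_power K_iff)
qed

lemma polar_form_surj:
  assumes "y \<notin> K" "c \<in> K"
  shows "\<exists>x. tr (x ^ q * (y + y ^ (q ^ 2))) = c"
proof -
  let ?d = "y + y ^ (q ^ 2)"
  have d: "?d \<noteq> 0" using radical_subset_K assms by blast
  obtain z where z: "tr z \<noteq> 0" using tr_not_zero by blast
  \<comment> \<open>By linearity over \<open>K\<close>, this scalar makes
    \<open>tr (s * z) = c\<close>.\<close>
  define s where "s = c * inverse (tr z)"
  have s: "s \<in> K"
    using assms tr_in_K[of z] by (simp add: s_def K_iff power_mult_distrib power_inverse)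
  \<comment> \<open>The exponent \<open>q ^ (n - 1)\<close> inverts the \<open>q\<close>-th power
    map, so \<open>x\<close> is the \<open>q\<close>-th root of \<open>s * z / ?d\<close>.\<close>
  define x where "x = (s * z / ?d) ^ (q ^ (n - 1))"
  have "x ^ q = (s * z / ?d) ^ (q ^ n)"
    using n_pos by (simp add: x_def mult.commute flip: power_mult power_Suc)
  then have "x ^ q * ?d = s * z" using d by (simp add: power_q_n)
  then have "tr (x ^ q * ?d) = c" using z by (simp add: tr_scale[OF s]) (simp add: s_def)
  then show ?thesis by blast
qed

lemma exists_T_add_eq_T_plus_1:
  assumes "y \<notin> K"
  shows "\<exists>x. T (x + y) = T x + 1"
proof -
  \<comment> \<open>Prescribing this value for the polar form cancels \<open>T y ^ 2\<close> and
    leaves the increment 1.\<close>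
  have "1 + T y ^ 2 \<in> K"
    by (simp add: power2_eq_square K_closed T_in_K)
  from polar_form_surj[OF assms this] obtain x
    where "tr (x ^ q * (y + y ^ (q ^ 2))) = 1 + T y ^ 2" by blast
  then have "T (x + y) ^ 2 = T x ^ 2 + 1 + (T y ^ 2 + T y ^ 2)"
    by (simp add: T_add_power_2 add_ac)
  then have "T (x + y) ^ 2 = (T x + 1) ^ 2"
    using power_2_power_add[of "T x" 1 1] by (simp add: add_self)
  then show ?thesis using square_inj by blast
qed

section \<open>The permutation criterion and the inverse\<close>

lemma inj_imp_coefficient:
  assumes "inj (\<lambda>x. x + \<gamma> * T x)"
  shows "\<gamma> \<in> K - {1}"
proof -
  have "\<gamma> \<in> K"
  proof (rule ccontr)
    assume \<gamma>: "\<gamma> \<notin> K"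
    then obtain x where "T (x + \<gamma>) = T x + 1" using exists_T_add_eq_T_plus_1 by blast
    then have "(x + \<gamma>) + \<gamma> * T (x + \<gamma>) = x + \<gamma> * T x + (\<gamma> + \<gamma>)"
      by (simp add: algebra_simps)
    then have "x + \<gamma> = x"
      unfolding add_self add_0_right by (rule injD[OF assms])
    then show False using \<gamma> K_closed by simp
  qed
  moreover have "\<gamma> \<noteq> 1"
  proof
    assume "\<gamma> = 1"
    \<comment> \<open>Both sides are 0, since \<open>T\<close> fixes 0 and 1.\<close>
    then have "0 + \<gamma> * T 0 = 1 + \<gamma> * T 1" using K_closed by (simp add: T_K two_eq_0)
    then have "(0 :: 'a) = 1" by (rule injD[OF assms])
    then show False by simp
  qed
  ultimately show ?thesis by simp
qed

lemma T_shift: "\<gamma> \<in> K \<Longrightarrow> T (x + \<gamma> * T x) = (1 + \<gamma>) * T x"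
  by (simp add: T_add_K K_closed T_in_K algebra_simps)

lemma one_plus_nonzero: "\<gamma> \<noteq> 1 \<Longrightarrow> 1 + \<gamma> \<noteq> (0 :: 'a)"
  by (metis add_eq_0_iff uminus_eq)

text \<open>The factor \<open>1 + \<gamma>\<close> from \<open>T_shift\<close> cancels the
  denominator, so \<open>\<gamma> * T x\<close> is added twice and vanishes.\<close>

lemma shift_inverse_left:
  assumes "\<gamma> \<in> K - {1}"
  shows "(x + \<gamma> * T x) + \<gamma> / (\<gamma> + 1) * T (x + \<gamma> * T x) = x"
proof -
  have "\<gamma> / (\<gamma> + 1) * T (x + \<gamma> * T x) = \<gamma> * T x"
    using assms one_plus_nonzero[of \<gamma>] by (simp add: T_shift add.commute)
  then show ?thesis by (simp add: add.assoc add_self)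
qed

lemma shift_inverse_right:
  assumes "\<gamma> \<in> K - {1}"
  shows "(x + \<gamma> / (\<gamma> + 1) * T x) + \<gamma> * T (x + \<gamma> / (\<gamma> + 1) * T x) = x"
proof -
  let ?f = "\<lambda>x. x + \<gamma> * T x" and ?g = "\<lambda>x. x + \<gamma> / (\<gamma> + 1) * T x"
  have left: "?g (?f x) = x" for x using shift_inverse_left[OF assms] by blast
  \<comment> \<open>On a finite field a left inverse suffices: \<open>?f\<close> is injective, hence
    onto, and every \<open>x\<close> has the form \<open>?f z\<close>.\<close>
  have "inj ?f" by (rule inj_on_inverseI[of _ ?g]) (rule left)
  then have "surj ?f" by (simp add: finite_UNIV_inj_surj)
  then obtain z where "x = ?f z" by (rule surjE)
  then show ?thesis by (simp only: left)
qed

end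

theorem theorem4p1:
  fixes m n q :: nat and \<gamma> :: "'a::{field,finite}" and K :: "'a set" and f :: "'a poly"
  assumes "m > 0" and "q = 2 ^ m" and "odd n"
    and "CARD('a) = q ^ n"
    and "subfield K (ring_of_type_algebra :: 'a ring)" and "card K = q"
  defines "f \<equiv> [:0, 1:] + smult \<gamma> (rel_trace q n ([:0, 1:] ^ ((q + q ^ 2) div 2)))"
  shows "(permutation_poly f \<longleftrightarrow> \<gamma> \<in> K - {1}) \<and>
    (\<gamma> \<in> K - {1} \<longrightarrow>
       compositional_inverse f
         ([:0, 1:] + smult (\<gamma> / (\<gamma> + 1)) (rel_trace q n ([:0, 1:] ^ ((q + q ^ 2) div 2)))))"
proof -
  interpret odd_extension_char_2 m n q K
    by (rule odd_extension_char_2.intro) (fact assms)+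
  \<comment> \<open>Keeping \<open>c\<close> arbitrary covers both \<open>f\<close> and the claimed
    inverse.\<close>
  have poly_shift: "poly ([:0, 1:] + smult c (rel_trace q n ([:0, 1:] ^ ((q + q ^ 2) div 2)))) =
      (\<lambda>x. x + c * T x)" for c
    by (simp add: fun_eq_iff poly_rel_trace T_def)
  have inj_iff: "permutation_poly f \<longleftrightarrow> inj (\<lambda>x. x + \<gamma> * T x)"
    unfolding permutation_poly_def f_def poly_shift bij_def
    using finite_UNIV_inj_surj[OF finite] by blast
  have inj: "inj (\<lambda>x. x + \<gamma> * T x)" if "\<gamma> \<in> K - {1}"
    by (rule inj_on_inverseI) (rule shift_inverse_left[OF that])
  show ?thesis
  proof (intro conjI impI)
    show "permutation_poly f \<longleftrightarrow> \<gamma> \<in> K - {1}"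
      unfolding inj_iff using inj inj_imp_coefficient by blast
  next
    assume \<gamma>: "\<gamma> \<in> K - {1}"
    let ?g = "[:0, 1:] + smult (\<gamma> / (\<gamma> + 1)) (rel_trace q n ([:0, 1:] ^ ((q + q ^ 2) div 2)))"
    have poly_f: "poly f x = x + \<gamma> * T x" for x
      by (simp only: f_def poly_shift)
    have poly_g: "poly ?g x = x + \<gamma> / (\<gamma> + 1) * T x" for x
      by (simp only: poly_shift)
    have "poly (pcompose ?g f) x = poly [:0, 1:] x" for x
      unfolding poly_pcompose poly_f poly_g shift_inverse_left[OF \<gamma>] by simp
    moreover have "poly (pcompose f ?g) x = poly [:0, 1:] x" for x
      unfolding poly_pcompose poly_f poly_g shift_inverse_right[OF \<gamma>] by simp
    ultimately show "compositional_inverse f ?g"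
      unfolding compositional_inverse_def
      by (intro conjI poly_cong_if_eq_everywhere)
  qed
qed

end
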